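(* Let $f\colon [0,\infty)\to (0,\infty)$ be a non-decreasing function such that $\sum_{n=1}^{\infty} \frac{1}{f(2^n)}=\infty$. Let $0<r<1\leq p$ and let $q=(p-r)/(1-r)$. Then there is a sequence of random variables $\{X_n\}_{n\geq 1}$ such that $\sup_{n\geq 1} \mathbb{E}(|X_n|^q f(|X_n|))<\infty$ and $$\sum_{n=1}^{\infty} n^{p/r-2}\, \mathbb{P}(|S_n|>n^{1/r})=\infty.$$
   Context: All random variables are real-valued and those in a sequence $\{X_n\}_{n\geq 1}$ are defined on the same probability space. For $n\geq 1$ let $S_n=\sum_{i=1}^n X_i$. *)

theory Defs
  imports "HOL-Probability.Probability"
begin

text \<open>
  Sequences are indexed from \<open>1\<close>; the value at index \<open>0\<close> is never used.
\<close>

definition partial_sum :: "(nat \<Rightarrow> 'a \<Rightarrow> real) \<Rightarrow> nat \<Rightarrow> 'a \<Rightarrow> real" where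
  "partial_sum X n \<omega> = (\<Sum>i=1..n. X i \<omega>)"

end

theory Submission
  imports Defs "HOL-Library.Discrete_Functions"
begin

text \<open>
  Put \<open>X\<^sub>i = v\<^sub>k 1\<^bsub>A\<^sub>k\<^esub>\<close> for \<open>2\<^sup>k \<le> i < 2\<^sup>k\<^sup>+\<^sup>1\<close>, where \<open>v\<^sub>k = c (2\<^sup>k)\<^bsup>1/r-1\<^esup>\<close> and \<open>A\<^sub>k\<close> is an
  event of probability of order \<open>(2\<^sup>k)\<^bsup>1-p/r\<^esup> / f v\<^sub>k\<close>. As \<open>q (1/r - 1) = p/r - 1\<close>, the moments
  are bounded. If \<open>A\<^sub>k\<close> occurs, the \<open>k\<close>-th dyadic block alone contributes \<open>c (2\<^sup>k)\<^bsup>1/r\<^esup>\<close> to the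
  partial sums, which for large \<open>c\<close> exceeds \<open>n\<^bsup>1/r\<^esup>\<close> for all \<open>n\<close> in the next block; hence
  the series dominates a multiple of \<open>\<Sum>k. 1 / f v\<^sub>k\<close>. Since \<open>v\<^sub>k\<close> grows geometrically,
  this diverges together with \<open>\<Sum>n. 1 / f (2\<^sup>n)\<close> by monotonicity of \<open>f\<close>.
\<close>

lemma suminf_disjoint_blocks_le:
  fixes g :: "nat \<Rightarrow> ennreal"
  assumes "disjoint_family B" and "\<And>k. finite (B k)"
  shows "(\<Sum>k. sum g (B k)) \<le> (\<Sum>n. g n)"
proof (rule suminf_le_const)
  show "summable (\<lambda>k. sum g (B k))" by simp
  fix K
  have "(\<Sum>k<K. sum g (B k)) = sum g (\<Union>k<K. B k)"
    using assms by (subst sum.UNION_disjoint) (auto simp: disjoint_family_on_def)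
  also have "\<dots> \<le> (\<Sum>n. g n)"
    using assms(2) by (intro sum_le_suminf) auto
  finally show "(\<Sum>k<K. sum g (B k)) \<le> (\<Sum>n. g n)" .
qed

text \<open>Cut the indices into blocks of length \<open>m\<close>: the first term of a block bounds
  the other \<open>m - 1\<close>. Thus divergence of a non-increasing series passes to its subseries
  along the multiples of \<open>m\<close>.\<close>

lemma suminf_antimono_le_multiples:
  fixes h :: "nat \<Rightarrow> ennreal"
  assumes "antimono h" and "0 < m"
  shows "(\<Sum>n. h n) \<le> of_nat m * (\<Sum>k. h (k * m))"
proof (rule suminf_le_const)
  show "summable h" by simp
  fix N
  have "(\<Sum>n<N. h n) \<le> (\<Sum>n<N * m. h n)"
    using assms(2) by (intro sum_mono2) (auto intro: less_le_trans)
  also have "\<dots> = (\<Sum>k<N. sum h {k * m..<k * m + m})"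
    by (simp add: sum.nat_group)
  also have "\<dots> \<le> (\<Sum>k<N. of_nat m * h (k * m))"
  proof (rule sum_mono)
    fix k
    have "sum h {k * m..<k * m + m} \<le> of_nat (card {k * m..<k * m + m}) * h (k * m)"
      by (rule sum_bounded_above) (use antimonoD[OF assms(1)] in auto)
    then show "sum h {k * m..<k * m + m} \<le> of_nat m * h (k * m)" by simp
  qed
  also have "\<dots> = of_nat m * (\<Sum>k<N. h (k * m))"
    by (simp add: sum_distrib_left)
  also have "\<dots> \<le> of_nat m * (\<Sum>k. h (k * m))"
    by (intro mult_left_mono sum_le_suminf) auto
  finally show "(\<Sum>n<N. h n) \<le> of_nat m * (\<Sum>k. h (k * m))" .
qed

text \<open>The arguments of \<open>f\<close> grow at most geometrically, so they stay below
  \<open>2 ^ (Suc k * m)\<close> for a suitable fixed \<open>m\<close>. As \<open>f\<close> is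
  non-decreasing, the series dominates a subseries of the given one along multiples of
  \<open>m\<close>.\<close>

lemma suminf_inverse_geometric_eq_top:
  fixes f :: "real \<Rightarrow> real"
  assumes mono: "mono_on {0..} f" and pos: "\<And>x. 0 \<le> x \<Longrightarrow> 0 < f x"
    and div: "(\<Sum>n. ennreal (1 / f (2 ^ Suc n))) = \<infinity>"
    and c: "0 < c" and t: "0 \<le> t"
  shows "(\<Sum>k. ennreal (1 / f (c * (2 ^ k) powr t))) = \<infinity>"
proof -
  define h where "h n = ennreal (1 / f (2 ^ Suc n))" for n
  obtain m1 where m1: "c < 2 ^ m1" using real_arch_pow[of 2 c] by auto
  \<comment> \<open>One \<open>m\<close> has to absorb both the factor,
    \<open>c \<le> 2 ^ m\<close>, and the exponent, \<open>t \<le> m\<close>.\<close>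
  define m where "m = Suc (m1 + nat \<lceil>t\<rceil>)"
  have m: "0 < m" "t \<le> real m"
    unfolding m_def by (simp, linarith)
  have cm: "c \<le> 2 ^ m"
    using m1 power_increasing[of m1 m "2 :: real"] by (simp add: m_def)
  have inverse_mono: "ennreal (1 / f y) \<le> ennreal (1 / f x)" if "0 \<le> x" "x \<le> y" for x y
    using that mono_onD[OF mono, of x y] pos[of x]
    by (intro ennreal_leI divide_left_mono) (auto intro!: mult_pos_pos pos)
  have "antimono h"
    unfolding h_def by (intro antimonoI inverse_mono power_increasing) auto
  then have "(\<Sum>n. h n) \<le> of_nat m * (\<Sum>k. h (k * m))"
    using m(1) by (rule suminf_antimono_le_multiples)
  with div have "(\<Sum>k. h (k * m)) = \<infinity>"
    by (auto simp: h_def top_unique ennreal_mult_eq_top_iff)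
  \<comment> \<open>Dropping the finite term \<open>h 0\<close> keeps the divergence, and the shift
    to \<open>Suc k\<close> supplies the spare factor \<open>2 ^ m\<close> that dominates
    \<open>c\<close>.\<close>
  moreover have "(\<Sum>k. h (k * m)) = (\<Sum>k. h (Suc k * m)) + h 0"
    using suminf_offset[of "\<lambda>k. h (k * m)" 1] by (simp add: add.commute)
  ultimately have "(\<Sum>k. h (Suc k * m)) = \<infinity>"
    by (metis ennreal_add_eq_top ennreal_neq_top h_def infinity_ennreal_def)
  moreover have "(\<Sum>k. h (Suc k * m)) \<le> (\<Sum>k. ennreal (1 / f (c * (2 ^ k) powr t)))"
  proof (rule suminf_le)
    fix k
    have "(2 ^ k) powr t \<le> (2 ^ k :: real) powr real m"
      using m(2) by (intro powr_mono) auto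
    also have "\<dots> = 2 ^ (k * m)" by (simp add: powr_realpow power_mult)
    finally have "c * (2 ^ k) powr t \<le> 2 ^ m * 2 ^ (k * m)"
      using cm c by (intro mult_mono) auto
    also have "\<dots> = 2 ^ (Suc k * m)" by (simp add: power_add)
    also have "\<dots> \<le> (2 ^ Suc (Suc k * m) :: real)" by (rule power_increasing) auto
    finally show "h (Suc k * m) \<le> ennreal (1 / f (c * (2 ^ k) powr t))"
      unfolding h_def using c by (intro inverse_mono) auto
  qed auto
  ultimately show ?thesis by (simp add: top_unique)
qed

text \<open>The ratio \<open>x / b\<close> lies in \<open>[1, C]\<close>, so its power is at least
  \<open>1\<close> if \<open>s \<ge> 0\<close> and at least \<open>C powr s\<close> otherwise. Both
  signs occur for the exponent \<open>p / r - 2\<close>.\<close>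

lemma min_powr_mult_le_powr:
  fixes x b s :: real
  assumes "0 < b" "b \<le> x" "x \<le> C * b"
  shows "min 1 (C powr s) * b powr s \<le> x powr s"
proof -
  define y where "y = x / b"
  have y: "1 \<le> y" "y \<le> C" "x = y * b" using assms by (auto simp: y_def field_simps)
  have "min 1 (C powr s) \<le> y powr s"
  proof (cases "0 \<le> s")
    case True
    then show ?thesis using y by (auto intro!: min.coboundedI1 ge_one_powr_ge_zero)
  next
    case False
    then show ?thesis using y by (auto intro!: min.coboundedI2 powr_mono2')
  qed
  then have "min 1 (C powr s) * b powr s \<le> y powr s * b powr s"
    by (rule mult_right_mono) auto
  then show ?thesis using y assms(1) by (simp add: powr_mult)
qed

text \<open>A uniform variable on \<open>[0, 1]\<close> is pushed forward to the constant sequences.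
  The sample space is then the required \<open>nat \<Rightarrow> real\<close>, and coordinate
  \<open>0\<close> is uniform, giving events of every probability.\<close>

lemma exists_prob_space_threshold_events:
  obtains M :: "(nat \<Rightarrow> real) measure"
  where "prob_space M" "space M = UNIV"
    "\<And>P. {\<omega>. \<omega> 0 \<le> P} \<in> sets M"
    "\<And>P. 0 \<le> P \<Longrightarrow> P \<le> 1 \<Longrightarrow> emeasure M {\<omega>. \<omega> 0 \<le> P} = ennreal P"
proof
  define U where "U = uniform_measure lborel {0..1::real}"
  define N :: "(nat \<Rightarrow> real) measure" where "N = PiM UNIV (\<lambda>_. borel)"
  define M where "M = distr U N (\<lambda>u _. u)"
  have U: "prob_space U" unfolding U_def by (intro prob_space_uniform_measure) auto
  have meas: "(\<lambda>u _. u) \<in> measurable U N"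
    unfolding N_def U_def by (intro measurable_PiM_single') auto
  show "prob_space M" unfolding M_def by (rule prob_space.prob_space_distr[OF U meas])
  show space: "space M = UNIV" by (simp add: M_def N_def space_PiM)
  have coord: "(\<lambda>\<omega>. \<omega> 0) \<in> measurable N borel"
    unfolding N_def by (rule measurable_component_singleton) simp
  show sets: "{\<omega>. \<omega> 0 \<le> P} \<in> sets M" for P :: real
    using measurable_sets[OF coord, of "{..P}"]
    by (simp add: M_def vimage_def N_def space_PiM)
  fix P :: real
  assume P: "0 \<le> P" "P \<le> 1"
  have "emeasure M {\<omega>. \<omega> 0 \<le> P} = emeasure U {..P}"
    using sets[of P] meas unfolding M_def
    by (subst emeasure_distr) (auto simp: vimage_def U_def atMost_def)
  also have "{0..1} \<inter> {..P} = {0..P}" using P by auto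
  then have "emeasure U {..P} = ennreal P"
    using P unfolding U_def by (subst emeasure_uniform_measure) (auto simp: divide_ennreal_def)
  finally show "emeasure M {\<omega>. \<omega> 0 \<le> P} = ennreal P" .
qed

theorem theorem4p2:
  fixes f :: "real \<Rightarrow> real" and p q r :: real
  assumes "mono_on {0..} f"
    and "\<And>x. 0 \<le> x \<Longrightarrow> 0 < f x"
    and "(\<Sum>n. ennreal (1 / f (2 ^ Suc n))) = \<infinity>"
    and "0 < r" and "r < 1" and "1 \<le> p"
    and "q = (p - r) / (1 - r)"
  shows "\<exists>(M :: (nat \<Rightarrow> real) measure) (X :: nat \<Rightarrow> (nat \<Rightarrow> real) \<Rightarrow> real).
    prob_space M \<and>
    (\<forall>n\<ge>1. X n \<in> borel_measurable M) \<and>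
    (SUP n\<in>{1..}. \<integral>\<^sup>+\<omega>. ennreal (\<bar>X n \<omega>\<bar> powr q * f \<bar>X n \<omega>\<bar>) \<partial>M) < \<infinity> \<and>
    (\<Sum>n. ennreal (real (Suc n) powr (p / r - 2) *
        \<P>(\<omega> in M. \<bar>partial_sum X (Suc n) \<omega>\<bar> > real (Suc n) powr (1 / r)))) = \<infinity>"
proof -
  note mono = assms(1) and pos = assms(2) and r = \<open>0 < r\<close> \<open>r < 1\<close> and p = \<open>1 \<le> p\<close>
  \<comment> \<open>The base \<open>8\<close> only has to exceed the \<open>4\<close> in
    \<open>n \<le> 4 * 2 ^ k\<close>, which makes the comparison in \<open>large\<close>
    strict.\<close>
  define c where "c = (8 :: real) powr (1 / r)"
  \<comment> \<open>From \<open>\<delta> \<le> f 0 \<le> f (v k)\<close> and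
    \<open>1 - p / r \<le> 0\<close> it follows that \<open>P k \<le> 1\<close>.\<close>
  define \<delta> where "\<delta> = min 1 (f 0)"
  define v where "v k = c * (2 ^ k) powr (1 / r - 1)" for k :: nat
  define P where "P k = \<delta> * (2 ^ k) powr (1 - p / r) / f (v k)" for k :: nat
  define D where "D = min 1 (4 powr (p / r - 2)) * \<delta>"
  have c: "0 < c" by (simp add: c_def)
  have \<delta>: "0 < \<delta>" "\<delta> \<le> 1" "\<delta> \<le> f 0" using pos[of 0] by (auto simp: \<delta>_def)
  have D: "0 < D" using \<delta> by (simp add: D_def)
  have v: "0 < v k" for k using c by (simp add: v_def)
  have fv: "0 < f (v k)" "\<delta> \<le> f (v k)" for k
    using pos[of "v k"] v[of k] \<delta>(3) mono_onD[OF mono, of 0 "v k"] by auto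
  have P0: "0 \<le> P k" for k using fv(1)[of k] \<delta> by (simp add: P_def)
  have P1: "P k \<le> 1" for k
  proof -
    have "(2 ^ k :: real) powr (1 - p / r) \<le> (2 ^ k) powr 0"
      using r p by (intro powr_mono) (auto simp: field_simps)
    then have "\<delta> * (2 ^ k) powr (1 - p / r) \<le> f (v k) * 1"
      using fv[of k] \<delta> by (intro mult_mono) auto
    then show ?thesis using fv(1)[of k] by (simp add: P_def field_simps)
  qed
  obtain M :: "(nat \<Rightarrow> real) measure" where M: "prob_space M" "space M = UNIV"
    and sets: "\<And>P. {\<omega>. \<omega> 0 \<le> P} \<in> sets M"
    and emeasure: "\<And>P. 0 \<le> P \<Longrightarrow> P \<le> 1 \<Longrightarrow> emeasure M {\<omega>. \<omega> 0 \<le> P} = ennreal P"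
    by (rule exists_prob_space_threshold_events) blast
  interpret prob_space M by (rule M(1))
  define A where "A k = {\<omega> :: nat \<Rightarrow> real. \<omega> 0 \<le> P k}" for k
  define X where "X n \<omega> = v (floor_log n) * indicator (A (floor_log n)) \<omega>" for n \<omega>
  have A: "A k \<in> sets M" "emeasure M (A k) = ennreal (P k)" for k
    using sets emeasure[OF P0 P1] by (auto simp: A_def)
  have X: "X n \<in> borel_measurable M" for n
    unfolding X_def
    by (intro borel_measurable_times borel_measurable_const borel_measurable_indicator A)
  have X0: "0 \<le> X n \<omega>" for n \<omega> using v[of "floor_log n"] by (simp add: X_def)

  have moment: "(\<integral>\<^sup>+\<omega>. ennreal (\<bar>X n \<omega>\<bar> powr q * f \<bar>X n \<omega>\<bar>) \<partial>M) = ennreal (c powr q * \<delta>)" for n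
  proof -
    let ?k = "floor_log n"
    \<comment> \<open>Off \<open>A ?k\<close> the integrand vanishes although
      \<open>f 0 > 0\<close>, because \<open>0 powr q = 0\<close>.\<close>
    have "(\<integral>\<^sup>+\<omega>. ennreal (\<bar>X n \<omega>\<bar> powr q * f \<bar>X n \<omega>\<bar>) \<partial>M) =
        (\<integral>\<^sup>+\<omega>. ennreal (v ?k powr q * f (v ?k)) * indicator (A ?k) \<omega> \<partial>M)"
      using v[of ?k] by (intro nn_integral_cong) (auto simp: X_def split: split_indicator)
    also have "\<dots> = ennreal (v ?k powr q * f (v ?k) * P ?k)"
      using A[of ?k] fv(1)[of ?k] P0[of ?k]
      by (subst nn_integral_cmult_indicator) (auto simp: ennreal_mult)
    also have "v ?k powr q * f (v ?k) * P ?k = v ?k powr q * (\<delta> * (2 ^ ?k) powr (1 - p / r))"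
      using fv(1)[of ?k] by (simp add: P_def)
    also have "v ?k powr q = c powr q * (2 ^ ?k) powr ((1 / r - 1) * q)"
      using c by (simp add: v_def powr_mult powr_powr)
    also have "(1 / r - 1) * q = p / r - 1"
      using r \<open>q = (p - r) / (1 - r)\<close> by (simp add: field_simps)
    also have "c powr q * (2 ^ ?k) powr (p / r - 1) * (\<delta> * (2 ^ ?k) powr (1 - p / r)) =
        c powr q * \<delta> * ((2 ^ ?k) powr (p / r - 1) * (2 ^ ?k) powr (1 - p / r))"
      by simp
    also have "\<dots> = c powr q * \<delta>"
      by (simp flip: powr_add)
    finally show ?thesis .
  qed

  have large: "real n powr (1 / r) < \<bar>partial_sum X n \<omega>\<bar>"
    if "\<omega> \<in> A k" "2 ^ Suc k \<le> n" "n \<le> 4 * 2 ^ k" for k n \<omega>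
  proof -
    have "real n powr (1 / r) \<le> (4 * 2 ^ k) powr (1 / r)"
      using that(3) r by (intro powr_mono2) (auto simp flip: of_nat_le_iff[where 'a = real])
    also have "\<dots> < (8 * 2 ^ k) powr (1 / r)"
      using r by (intro powr_less_mono2) auto
    also have "\<dots> = 2 ^ k * v k"
      by (simp add: c_def v_def powr_mult powr_diff)
    also have "\<dots> = (\<Sum>i\<in>{2 ^ k..<2 ^ Suc k :: nat}. v k)" by simp
    also have "\<dots> = (\<Sum>i\<in>{2 ^ k..<2 ^ Suc k}. X i \<omega>)"
    proof (rule sum.cong)
      fix i :: nat assume i: "i \<in> {2 ^ k..<2 ^ Suc k}"
      then have "floor_log i = k"
        by (intro floor_log_eqI) (auto intro: less_le_trans[of 0 "2 ^ k"])
      then show "v k = X i \<omega>" using that(1) by (simp add: X_def)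
    qed simp
    \<comment> \<open>The whole \<open>k\<close>-th block lies in \<open>{1..n}\<close>, and the
      remaining summands are nonnegative.\<close>
    also have "\<dots> \<le> partial_sum X n \<omega>"
      unfolding partial_sum_def using that(2) X0
      by (intro sum_mono2) (auto intro: order.trans[of 1 "2 ^ k"])
    finally show ?thesis by linarith
  qed

  let ?t = "\<lambda>n. ennreal (real (Suc n) powr (p / r - 2) *
        \<P>(\<omega> in M. \<bar>partial_sum X (Suc n) \<omega>\<bar> > real (Suc n) powr (1 / r)))"
  \<comment> \<open>The term of index \<open>n\<close> concerns \<open>Suc n\<close>, which may
    equal \<open>4 * 2 ^ k\<close> here; hence the non-strict upper bound in
    \<open>large\<close>.\<close>
  define B where "B k = {2 ^ Suc k..<2 ^ Suc (Suc k) :: nat}" for k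
  have block: "ennreal (D * (1 / f (v k))) \<le> sum ?t (B k)" for k
  proof -
    \<comment> \<open>The weight is of order at least \<open>(2 ^ k) powr (p / r - 2)\<close>, and
      multiplying by \<open>P k\<close> leaves \<open>1 / 2 ^ k\<close> times a constant over
      \<open>f (v k)\<close>.\<close>
    have term_ge: "ennreal (D * (1 / f (v k)) / 2 ^ k) \<le> ?t n" if "n \<in> B k" for n
    proof -
      from that have n: "2 ^ Suc k \<le> Suc n" "Suc n \<le> 4 * 2 ^ k" by (auto simp: B_def)
      then have nr: "(2 ^ k :: real) \<le> real (Suc n)" "real (Suc n) \<le> 4 * 2 ^ k"
        by (simp_all flip: of_nat_le_iff[where 'a = real])
      have "P k = prob (A k)" using A(2)[of k] P0[of k] by (simp add: measure_def)
      also have "\<dots> \<le> \<P>(\<omega> in M. \<bar>partial_sum X (Suc n) \<omega>\<bar> > real (Suc n) powr (1 / r))"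
      proof (rule finite_measure_mono)
        show "A k \<subseteq> {\<omega> \<in> space M. \<bar>partial_sum X (Suc n) \<omega>\<bar> > real (Suc n) powr (1 / r)}"
          using large[OF _ n] M(2) by auto
        have [measurable]: "partial_sum X (Suc n) \<in> borel_measurable M"
          unfolding partial_sum_def[abs_def] using X by (intro borel_measurable_sum)
        show "{\<omega> \<in> space M. \<bar>partial_sum X (Suc n) \<omega>\<bar> > real (Suc n) powr (1 / r)} \<in> events"
          by measurable
      qed
      finally have "min 1 (4 powr (p / r - 2)) * (2 ^ k) powr (p / r - 2) * P k \<le>
          real (Suc n) powr (p / r - 2) *
          \<P>(\<omega> in M. \<bar>partial_sum X (Suc n) \<omega>\<bar> > real (Suc n) powr (1 / r))"
        using P0 nr by (intro mult_mono min_powr_mult_le_powr) auto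
      also have "min 1 (4 powr (p / r - 2)) * (2 ^ k) powr (p / r - 2) * P k =
          D * (1 / f (v k)) * ((2 ^ k) powr (p / r - 2) * (2 ^ k) powr (1 - p / r))"
        by (simp add: P_def D_def)
      also have "(2 ^ k) powr (p / r - 2) * (2 ^ k) powr (1 - p / r) = 1 / (2 ^ k :: real)"
        by (simp add: powr_minus_divide flip: powr_add)
      finally show ?thesis by (intro ennreal_leI) simp
    qed
    \<comment> \<open>The \<open>2 ^ Suc k\<close> indices in \<open>B k\<close> outweigh the factor
      \<open>1 / 2 ^ k\<close>.\<close>
    have "ennreal (D * (1 / f (v k))) \<le> ennreal (real (card (B k)) * (D * (1 / f (v k)) / 2 ^ k))"
      using D fv(1)[of k] by (intro ennreal_leI) (simp add: B_def divide_right_mono)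
    also have "\<dots> = of_nat (card (B k)) * ennreal (D * (1 / f (v k)) / 2 ^ k)"
      using D fv(1)[of k] by (subst ennreal_mult) (auto simp: ennreal_of_nat_eq_real_of_nat)
    also have "\<dots> \<le> sum ?t (B k)"
      using term_ge by (rule sum_bounded_below)
    finally show ?thesis .
  qed
  have "(\<Sum>k. ennreal (1 / f (v k))) = \<infinity>"
    unfolding v_def using assms(1-3) c r by (intro suminf_inverse_geometric_eq_top) auto
  then have "\<infinity> = ennreal D * (\<Sum>k. ennreal (1 / f (v k)))"
    using D by (simp add: ennreal_mult_top)
  also have "\<dots> = (\<Sum>k. ennreal (D * (1 / f (v k))))"
    unfolding ennreal_suminf_cmult[symmetric] using D fv(1)
    by (intro suminf_cong ennreal_mult[symmetric]) (auto simp: less_imp_le)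
  also have "\<dots> \<le> (\<Sum>k. sum ?t (B k))"
    using block by (intro suminf_le) auto
  also have "\<dots> \<le> (\<Sum>n. ?t n)"
  proof (rule suminf_disjoint_blocks_le)
    \<comment> \<open>An index determines its block through \<open>floor_log\<close>, so the blocks
      are disjoint.\<close>
    have "floor_log n = Suc k" if "n \<in> B k" for n k
      using that unfolding B_def
      by (intro floor_log_eqI) (auto intro: less_le_trans[of 0 "2 * 2 ^ k"])
    then show "disjoint_family B"
      unfolding disjoint_family_on_def by (metis disjoint_iff nat.inject)
  qed (simp add: B_def)
  finally have "(\<Sum>n. ?t n) = \<infinity>" by (simp add: top_unique)
  moreover have "(SUP n\<in>{1..}. \<integral>\<^sup>+\<omega>. ennreal (\<bar>X n \<omega>\<bar> powr q * f \<bar>X n \<omega>\<bar>) \<partial>M) < \<infinity>"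
    unfolding moment by simp
  ultimately show ?thesis using M(1) X
    by (intro exI[of _ M] exI[of _ X] conjI allI impI)
qed

end
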